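(* In a point-free relation algebra, for all pers $P$ and $Q$ (of the same type), $$P\subseteq\mathbb{I}\;\wedge\;P\preceq Q\quad\equiv\quad P\text{ is an index of }Q .$$
   Context: A point-free relation algebra consists of the following. There is a non-empty set of basic types; each element (relation) $X$ has a type $A\sim B$ for basic types $A,B$. Monoid structure: for $X$ of type $A\sim B$ and $Y$ of type $B\sim C$ there is a composition $X\circ Y$ of type $A\sim C$; composition is associative, and for each basic type $A$ there is an identity $\mathbb{I}$ of type $A\sim A$ which is a unit of composition. Lattice structure: the relations of each type $A\sim B$ form a (finitely) distributive lattice ordered by $\subseteq$ with join $\cup$, meet $\cap$, least element $\bot$ and greatest element $\top$ (types of $\mathbb{I},\bot,\top$ are deduced from context). Factors: there are operators $\setminus$ and $/$ with $(Y\subseteq X\setminus Z)\equiv (X\circ Y\subseteq Z)\equiv (X\subseteq Z/Y)$. Converse: for each $X$ of type $A\sim B$ there is $X^{\smile}$ of type $B\sim A$, with $X^{\smile}\subseteq Y\equiv X\subseteq Y^{\smile}$, $\mathbb{I}^{\smile}=\mathbb{I}$, $(X\circ Y)^{\smile}=Y^{\smile}\circ X^{\smile}$. Modularity law: $X\circ Y\cap Z\subseteq X\circ(Y\cap X^{\smile}\circ Z)$. Complements and the cone rule are not assumed. A per is a relation $P$ (of some type $A\sim A$) with $P=P^{\smile}$ and $P\circ P\subseteq P$. For a per $P$, $\mathrm{dom}(P)=\mathbb{I}\cap P$ is its (left and right) domain. Thins: for pers $P,Q$ of the same type, $P\preceq Q$ iff $P=\mathrm{dom}(P)\circ Q\circ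 \mathrm{dom}(P)$ and $Q=Q\circ \mathrm{dom}(P)\circ Q$. An index of a per $P$ is a relation $J$ with (a) $J\subseteq \mathrm{dom}(P)$, (b) $J\circ P\circ J=J$, (c) $P\circ J\circ P=P$. *)

theory Defs
  imports Main
begin

text \<open>
  Relations are the elements of \<open>relations R\<close>; a relation \<open>X\<close> has the type
  \<open>src R X \<sim> tgt R X\<close>.  The constants \<open>ident\<close>, \<open>least\<close> and \<open>greatest\<close>, whose types are
  left to the context on paper, take their type as an argument.  All operations are total HOL
  functions; nothing is assumed of them on arguments that are not relations or whose types do
  not fit, nor of \<open>\<sqsubseteq>\<close> between relations of different types.
\<close>

record ('a, 't) typed_relations =
  basic_types :: "'t set"
  relations :: "'a set"
  src :: "'a \<Rightarrow> 't"
  tgt :: "'a \<Rightarrow> 't"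
  compose :: "'a \<Rightarrow> 'a \<Rightarrow> 'a" (infixl "\<odot>\<index>" 75)
  ident :: "'t \<Rightarrow> 'a" ("\<I>\<index>")
  leq :: "'a \<Rightarrow> 'a \<Rightarrow> bool" (infix "\<sqsubseteq>\<index>" 50)
  join :: "'a \<Rightarrow> 'a \<Rightarrow> 'a" (infixl "\<squnion>\<index>" 65)
  meet :: "'a \<Rightarrow> 'a \<Rightarrow> 'a" (infixl "\<sqinter>\<index>" 70)
  least :: "'t \<Rightarrow> 't \<Rightarrow> 'a" ("\<bottom>\<index>")
  greatest :: "'t \<Rightarrow> 't \<Rightarrow> 'a" ("\<top>\<index>")
  left_factor :: "'a \<Rightarrow> 'a \<Rightarrow> 'a" (infixr "\<setminus>\<index>" 72)
  right_factor :: "'a \<Rightarrow> 'a \<Rightarrow> 'a" (infixl "\<sslash>\<index>" 72)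
  conv :: "'a \<Rightarrow> 'a" ("_\<^sup>\<smile>\<index>" [1000] 999)

definition rel :: "('a, 't, 'm) typed_relations_scheme \<Rightarrow> 't \<Rightarrow> 't \<Rightarrow> 'a set" where
  "rel R A B = {X \<in> relations R. src R X = A \<and> tgt R X = B}"

locale point_free_relation_algebra =
  fixes R :: "('a, 't, 'm) typed_relations_scheme" (structure)
  assumes basic_types_nonempty: "basic_types R \<noteq> {}"
    and src_basic_type: "X \<in> relations R \<Longrightarrow> src R X \<in> basic_types R"
    and tgt_basic_type: "X \<in> relations R \<Longrightarrow> tgt R X \<in> basic_types R"
    and comp_type: "\<lbrakk>X \<in> rel R A B; Y \<in> rel R B C\<rbrakk> \<Longrightarrow> X \<odot> Y \<in> rel R A C"
    and comp_assoc: "\<lbrakk>X \<in> rel R A B; Y \<in> rel R B C; Z \<in> rel R C D\<rbrakk>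
          \<Longrightarrow> (X \<odot> Y) \<odot> Z = X \<odot> (Y \<odot> Z)"
    and ident_type: "A \<in> basic_types R \<Longrightarrow> \<I> A \<in> rel R A A"
    and ident_left: "X \<in> rel R A B \<Longrightarrow> \<I> A \<odot> X = X"
    and ident_right: "X \<in> rel R A B \<Longrightarrow> X \<odot> \<I> B = X"
    and leq_refl: "X \<in> rel R A B \<Longrightarrow> X \<sqsubseteq> X"
    and leq_antisym: "\<lbrakk>X \<in> rel R A B; Y \<in> rel R A B; X \<sqsubseteq> Y; Y \<sqsubseteq> X\<rbrakk> \<Longrightarrow> X = Y"
    and leq_trans: "\<lbrakk>X \<in> rel R A B; Y \<in> rel R A B; Z \<in> rel R A B; X \<sqsubseteq> Y; Y \<sqsubseteq> Z\<rbrakk>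
          \<Longrightarrow> X \<sqsubseteq> Z"
    and join_type: "\<lbrakk>X \<in> rel R A B; Y \<in> rel R A B\<rbrakk> \<Longrightarrow> X \<squnion> Y \<in> rel R A B"
    and join_lub: "\<lbrakk>X \<in> rel R A B; Y \<in> rel R A B; Z \<in> rel R A B\<rbrakk>
          \<Longrightarrow> X \<squnion> Y \<sqsubseteq> Z \<longleftrightarrow> X \<sqsubseteq> Z \<and> Y \<sqsubseteq> Z"
    and meet_type: "\<lbrakk>X \<in> rel R A B; Y \<in> rel R A B\<rbrakk> \<Longrightarrow> X \<sqinter> Y \<in> rel R A B"
    and meet_glb: "\<lbrakk>X \<in> rel R A B; Y \<in> rel R A B; Z \<in> rel R A B\<rbrakk>
          \<Longrightarrow> Z \<sqsubseteq> X \<sqinter> Y \<longleftrightarrow> Z \<sqsubseteq> X \<and> Z \<sqsubseteq> Y"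
    and least_type: "\<lbrakk>A \<in> basic_types R; B \<in> basic_types R\<rbrakk> \<Longrightarrow> \<bottom> A B \<in> rel R A B"
    and least_leq: "X \<in> rel R A B \<Longrightarrow> \<bottom> A B \<sqsubseteq> X"
    and greatest_type: "\<lbrakk>A \<in> basic_types R; B \<in> basic_types R\<rbrakk> \<Longrightarrow> \<top> A B \<in> rel R A B"
    and leq_greatest: "X \<in> rel R A B \<Longrightarrow> X \<sqsubseteq> \<top> A B"
    and meet_join_distrib: "\<lbrakk>X \<in> rel R A B; Y \<in> rel R A B; Z \<in> rel R A B\<rbrakk>
          \<Longrightarrow> X \<sqinter> (Y \<squnion> Z) = (X \<sqinter> Y) \<squnion> (X \<sqinter> Z)"
    and left_factor_type: "\<lbrakk>X \<in> rel R A B; Z \<in> rel R A C\<rbrakk> \<Longrightarrow> X \<setminus> Z \<in> rel R B C"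
    and right_factor_type: "\<lbrakk>Z \<in> rel R A C; Y \<in> rel R B C\<rbrakk> \<Longrightarrow> Z \<sslash> Y \<in> rel R A B"
    and left_factor_galois: "\<lbrakk>X \<in> rel R A B; Y \<in> rel R B C; Z \<in> rel R A C\<rbrakk>
          \<Longrightarrow> Y \<sqsubseteq> X \<setminus> Z \<longleftrightarrow> X \<odot> Y \<sqsubseteq> Z"
    and right_factor_galois: "\<lbrakk>X \<in> rel R A B; Y \<in> rel R B C; Z \<in> rel R A C\<rbrakk>
          \<Longrightarrow> X \<odot> Y \<sqsubseteq> Z \<longleftrightarrow> X \<sqsubseteq> Z \<sslash> Y"
    and converse_type: "X \<in> rel R A B \<Longrightarrow> X\<^sup>\<smile> \<in> rel R B A"
    and converse_galois: "\<lbrakk>X \<in> rel R A B; Y \<in> rel R B A\<rbrakk> \<Longrightarrow> X\<^sup>\<smile> \<sqsubseteq> Y \<longleftrightarrow> X \<sqsubseteq> Y\<^sup>\<smile>"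
    and converse_ident: "A \<in> basic_types R \<Longrightarrow> (\<I> A)\<^sup>\<smile> = \<I> A"
    and converse_comp: "\<lbrakk>X \<in> rel R A B; Y \<in> rel R B C\<rbrakk> \<Longrightarrow> (X \<odot> Y)\<^sup>\<smile> = Y\<^sup>\<smile> \<odot> X\<^sup>\<smile>"
    and modularity: "\<lbrakk>X \<in> rel R A B; Y \<in> rel R B C; Z \<in> rel R A C\<rbrakk>
          \<Longrightarrow> (X \<odot> Y) \<sqinter> Z \<sqsubseteq> X \<odot> (Y \<sqinter> (X\<^sup>\<smile> \<odot> Z))"

definition per :: "('a, 't, 'm) typed_relations_scheme \<Rightarrow> 'a \<Rightarrow> bool" where
  "per R P \<longleftrightarrow> P \<in> rel R (src R P) (src R P) \<and>
     P = P\<^sup>\<smile>\<^bsub>R\<^esub> \<and> P \<odot>\<^bsub>R\<^esub> P \<sqsubseteq>\<^bsub>R\<^esub> P"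

definition per_dom :: "('a, 't, 'm) typed_relations_scheme \<Rightarrow> 'a \<Rightarrow> 'a" where
  "per_dom R P = \<I>\<^bsub>R\<^esub> (src R P) \<sqinter>\<^bsub>R\<^esub> P"

definition thins :: "('a, 't, 'm) typed_relations_scheme \<Rightarrow> 'a \<Rightarrow> 'a \<Rightarrow> bool"
    (infix "\<preceq>\<index>" 50) where
  "P \<preceq>\<^bsub>R\<^esub> Q \<longleftrightarrow> per R P \<and> per R Q \<and> src R P = src R Q \<and>
     P = per_dom R P \<odot>\<^bsub>R\<^esub> Q \<odot>\<^bsub>R\<^esub> per_dom R P \<and>
     Q = Q \<odot>\<^bsub>R\<^esub> per_dom R P \<odot>\<^bsub>R\<^esub> Q"

text \<open>An index \<open>J\<close> of \<open>P\<close> is not required to be a per.\<close>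

definition is_index :: "('a, 't, 'm) typed_relations_scheme \<Rightarrow> 'a \<Rightarrow> 'a \<Rightarrow> bool" where
  "is_index R J P \<longleftrightarrow> per R P \<and> J \<in> rel R (src R P) (src R P) \<and>
     J \<sqsubseteq>\<^bsub>R\<^esub> per_dom R P \<and>
     J \<odot>\<^bsub>R\<^esub> P \<odot>\<^bsub>R\<^esub> J = J \<and>
     P \<odot>\<^bsub>R\<^esub> J \<odot>\<^bsub>R\<^esub> P = P"

end

theory Submission
  imports Defs
begin

text \<open>
  If \<open>P \<subseteq> \<I>\<close> then \<open>dom P = P\<close>, so the two thins equations become the index conditions (b)
  and (c).  Condition (a) then follows from (b): \<open>P = P \<circ> Q \<circ> P \<subseteq> \<I> \<circ> Q \<circ> \<I> = Q\<close>.
\<close>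

context point_free_relation_algebra
begin

lemma meet_absorb2:
  assumes X: "X \<in> rel R A B" and Y: "Y \<in> rel R A B" and "Y \<sqsubseteq> X"
  shows "X \<sqinter> Y = Y"
  using assms by (meson leq_antisym leq_refl meet_glb meet_type)

text \<open>Monotonicity is not among the axioms; it comes from the Galois connection with the
  factors. Composing with \<open>Y\<close> on the right is a lower adjoint of
  \<open>_ \<sslash> Y\<close>, so \<open>X'\<close>, and hence \<open>X\<close>, lies below the
  factor \<open>(X' \<odot> Y) \<sslash> Y\<close>.\<close>

lemma comp_mono_left:
  assumes X: "X \<in> rel R A B" and X': "X' \<in> rel R A B" and Y: "Y \<in> rel R B C" and le: "X \<sqsubseteq> X'"
  shows "X \<odot> Y \<sqsubseteq> X' \<odot> Y"
proof -
  have X'Y: "X' \<odot> Y \<in> rel R A C" using X' Y by (rule comp_type)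
  have "X' \<sqsubseteq> (X' \<odot> Y) \<sslash> Y"
    using right_factor_galois[OF X' Y X'Y] leq_refl[OF X'Y] by blast
  then have "X \<sqsubseteq> (X' \<odot> Y) \<sslash> Y"
    using leq_trans[OF X X' right_factor_type[OF X'Y Y]] le by blast
  then show ?thesis using right_factor_galois[OF X Y X'Y] by blast
qed

lemma comp_mono_right:
  assumes X: "X \<in> rel R A B" and Y: "Y \<in> rel R B C" and Y': "Y' \<in> rel R B C" and le: "Y \<sqsubseteq> Y'"
  shows "X \<odot> Y \<sqsubseteq> X \<odot> Y'"
proof -
  have XY': "X \<odot> Y' \<in> rel R A C" using X Y' by (rule comp_type)
  have "Y' \<sqsubseteq> X \<setminus> (X \<odot> Y')"
    using left_factor_galois[OF X Y' XY'] leq_refl[OF XY'] by blast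
  then have "Y \<sqsubseteq> X \<setminus> (X \<odot> Y')"
    using leq_trans[OF Y Y' left_factor_type[OF X XY']] le by blast
  then show ?thesis using left_factor_galois[OF X Y XY'] by blast
qed

text \<open>By monotonicity \<open>K\<close> and then \<open>J\<close> can be enlarged to
  identities, which vanish as units of composition.\<close>

lemma comp_coreflexives_leq:
  assumes J: "J \<in> rel R A A" and K: "K \<in> rel R B B" and X: "X \<in> rel R A B"
    and A: "A \<in> basic_types R" and B: "B \<in> basic_types R"
    and "J \<sqsubseteq> \<I> A" and "K \<sqsubseteq> \<I> B"
  shows "J \<odot> X \<odot> K \<sqsubseteq> X"
proof -
  have JX: "J \<odot> X \<in> rel R A B" using J X by (rule comp_type)
  have "J \<odot> X \<odot> K \<sqsubseteq> J \<odot> X"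
    using comp_mono_right[OF JX K ident_type[OF B]] assms ident_right[OF JX] by simp
  moreover have "J \<odot> X \<sqsubseteq> X"
    using comp_mono_left[OF J ident_type[OF A] X] assms ident_left[OF X] by simp
  ultimately show ?thesis
    using leq_trans[OF comp_type[OF JX K] JX X] by blast
qed

end

theorem theorem14:
  fixes R :: "('a, 't, 'm) typed_relations_scheme" (structure) and P Q :: 'a
  assumes "point_free_relation_algebra R"
    and "per R P" and "per R Q" and "src R P = src R Q"
  shows "P \<sqsubseteq> \<I> (src R P) \<and> P \<preceq> Q \<longleftrightarrow> is_index R P Q"
proof -
  interpret point_free_relation_algebra R by fact
  \<comment> \<open>All typing is done at the source of \<open>Q\<close>, the one to which
    \<open>is_index R P Q\<close> refers; \<open>assms(4)\<close> carries facts over from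
    \<open>src R P\<close>.\<close>
  let ?A = "src R Q"
  have P: "P \<in> rel R ?A ?A" and Q: "Q \<in> rel R ?A ?A"
    using assms by (auto simp: per_def)
  then have A: "?A \<in> basic_types R" using src_basic_type by (auto simp: rel_def)
  note I = ident_type[OF A]
  have dom_P: "per_dom R P = P" if "P \<sqsubseteq> \<I> ?A"
    using meet_absorb2[OF I P that] assms(4) by (simp add: per_dom_def)
  \<comment> \<open>Splits condition (a) by the universal property of the meet. One direction of the
    theorem assembles both halves, the other extracts coreflexivity.\<close>
  have dom_Q: "P \<sqsubseteq> per_dom R Q \<longleftrightarrow> P \<sqsubseteq> \<I> ?A \<and> P \<sqsubseteq> Q"
    using meet_glb[OF I Q P] by (simp add: per_dom_def)
  show ?thesis
  proof
    assume *: "P \<sqsubseteq> \<I> (src R P) \<and> P \<preceq> Q"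
    then have PI: "P \<sqsubseteq> \<I> ?A" using assms(4) by simp
    have b: "P \<odot> Q \<odot> P = P" and c: "Q \<odot> P \<odot> Q = Q"
      using * dom_P[OF PI] by (auto simp: thins_def)
    \<comment> \<open>Both coreflexives are \<open>P\<close> itself, and \<open>b\<close> collapses
      the restricted \<open>Q\<close> to \<open>P\<close>.\<close>
    have "P \<sqsubseteq> Q" using comp_coreflexives_leq[OF P P Q A A PI PI] b by simp
    then show "is_index R P Q" using b c PI P assms(3) dom_Q by (simp add: is_index_def)
  next
    assume *: "is_index R P Q"
    \<comment> \<open>Once \<open>P\<close> is known to be coreflexive, \<open>dom_P\<close> turns
      (b) and (c) back into the thins equations.\<close>
    then have "P \<sqsubseteq> \<I> ?A" using dom_Q by (simp add: is_index_def)
    then show "P \<sqsubseteq> \<I> (src R P) \<and> P \<preceq> Q"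
      using * dom_P assms by (simp add: is_index_def thins_def)
  qed
qed

end
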